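(* Let $G$ be a tree or a unicyclic graph with maximum degree $\Delta \geq 2$. For $0 \leq \alpha \leq 1$, $$\rho_\alpha(G) \leq \alpha\Delta + 2(1-\alpha)\sqrt{\Delta-1},$$ and for $0 \leq \alpha < 1$ equality holds if and only if $G$ is a cycle.
   Context: All graphs are finite, simple and undirected. For a graph $G$, $A(G)$ is its adjacency matrix and $D(G)$ the diagonal matrix of vertex degrees. For $\alpha\in[0,1]$, $A_\alpha(G) = \alpha D(G) + (1-\alpha)A(G)$, and the $\alpha$-spectral radius $\rho_\alpha(G)$ is the largest eigenvalue of $A_\alpha(G)$. A unicyclic graph is a connected graph containing exactly one cycle. *)

theory Defs
  imports
    "Graph_Theory.Pair_Digraph"
    "Graph_Theory.Digraph_Component"
    "Jordan_Normal_Form.Spectral_Radius"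
begin

text \<open>
  Finite simple undirected graphs are the symmetric loop-free digraphs of \<^locale>\<open>pair_graph\<close>:
  the edge \<open>uv\<close> is the pair of arcs \<open>(u, v)\<close>, \<open>(v, u)\<close>, so the degree of a vertex is its
  out-degree. The library's \<^const>\<open>forest\<close> and \<^const>\<open>tree\<close> are not usable here, since in a
  symmetric digraph the walk \<open>u, v, u\<close> counts as a (directed) cycle.
\<close>

definition cycle_graph :: "'v pair_pre_digraph \<Rightarrow> bool" where
  "cycle_graph C \<longleftrightarrow> (\<exists>us. 3 \<le> length us \<and> distinct us \<and> pverts C = set us \<and>
     parcs C = (\<Union>i<length us.
       {(us ! i, us ! (Suc i mod length us)), (us ! (Suc i mod length us), us ! i)}))"

text \<open>The cycles contained in a graph are its subgraphs that are cycle graphs, so that a cycle has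
  no distinguished starting vertex or orientation.\<close>

definition cycle_in :: "'v pair_pre_digraph \<Rightarrow> 'v pair_pre_digraph \<Rightarrow> bool" where
  "cycle_in C G \<longleftrightarrow> cycle_graph C \<and> subgraph (with_proj C) (with_proj G)"

definition tree_graph :: "'v pair_pre_digraph \<Rightarrow> bool" where
  "tree_graph G \<longleftrightarrow>
     pair_graph G \<and> Digraph_Component.connected (with_proj G) \<and> (\<nexists>C. cycle_in C G)"

definition unicyclic_graph :: "'v pair_pre_digraph \<Rightarrow> bool" where
  "unicyclic_graph G \<longleftrightarrow>
     pair_graph G \<and> Digraph_Component.connected (with_proj G) \<and> (\<exists>!C. cycle_in C G)"

definition degree_of :: "'v pair_pre_digraph \<Rightarrow> 'v \<Rightarrow> nat" where
  "degree_of G v = out_degree (with_proj G) v"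

definition max_degree :: "'v pair_pre_digraph \<Rightarrow> nat" where
  "max_degree G = Max (degree_of G ` pverts G)"

text \<open>The rows and columns of the matrices are indexed along an enumeration \<open>vs\<close> of the vertices.\<close>

definition enumerates_verts :: "'v list \<Rightarrow> 'v pair_pre_digraph \<Rightarrow> bool" where
  "enumerates_verts vs G \<longleftrightarrow> distinct vs \<and> set vs = pverts G"

definition adjacency_mat :: "'v pair_pre_digraph \<Rightarrow> 'v list \<Rightarrow> real mat" where
  "adjacency_mat G vs = mat (length vs) (length vs)
     (\<lambda>(i, j). if (vs ! i, vs ! j) \<in> parcs G then 1 else 0)"

definition degree_mat :: "'v pair_pre_digraph \<Rightarrow> 'v list \<Rightarrow> real mat" where
  "degree_mat G vs = mat (length vs) (length vs)
     (\<lambda>(i, j). if i = j then real (degree_of G (vs ! i)) else 0)"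

definition A_alpha :: "real \<Rightarrow> 'v pair_pre_digraph \<Rightarrow> 'v list \<Rightarrow> real mat" where
  "A_alpha \<alpha> G vs = \<alpha> \<cdot>\<^sub>m degree_mat G vs + (1 - \<alpha>) \<cdot>\<^sub>m adjacency_mat G vs"

definition rho_alpha :: "real \<Rightarrow> 'v pair_pre_digraph \<Rightarrow> 'v list \<Rightarrow> real" where
  "rho_alpha \<alpha> G vs = Max (spectrum (A_alpha \<alpha> G vs))"

end

theory Submission
  imports Defs
begin

text \<open>
  A graph with at most one cycle can be oriented so that every vertex has out-degree at most one: in
  a forest delete leaves one by one, pointing each leaf to its neighbour and sparing a chosen root;
  if there is a cycle, first delete one of its edges \<open>vw\<close>, root the rest at \<open>v\<close>, and orient
  \<open>v \<rightarrow> w\<close>. Put \<open>s = \<surd>(\<Delta> - 1)\<close> and bound the contribution of each oriented edge \<open>v \<rightarrow> u\<close> to the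
  quadratic form of the adjacency matrix by \<open>2 f(v) f(u) \<le> s f(v)\<^sup>2 + f(u)\<^sup>2 / s\<close>. A vertex \<open>v\<close> then
  carries the weight \<open>s out(v) + in(v) / s\<close>, which is at most \<open>2 s\<close> since \<open>out(v) \<le> 1\<close>,
  \<open>out(v) + in(v) \<le> \<Delta>\<close> and \<open>\<Delta> \<ge> 2\<close>.

  In case of equality \<open>f(u) = s f(v)\<close> along every oriented edge, so by connectedness \<open>f\<close> vanishes
  nowhere and every weight is exactly \<open>2 s\<close>. This forces \<open>in(v) \<ge> \<Delta> - 1 \<ge> 1 \<ge> out(v)\<close>; as the
  in-degrees and the out-degrees have the same sum, all of them are 1, and the graph is connected and
  2-regular, that is, a cycle.
\<close>

section \<open>Cycles as vertex lists, and orientations\<close>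

definition cycle_arcs :: "'v list \<Rightarrow> ('v \<times> 'v) set" where
  "cycle_arcs us = (\<Union>i<length us.
     {(us ! i, us ! (Suc i mod length us)), (us ! (Suc i mod length us), us ! i)})"

text \<open>A cycle is judged by its arcs alone, so that deleting an edge changes only the relation
  \<open>E\<close>, with no vertex set to adjust.\<close>

definition is_cycle :: "('v \<times> 'v) set \<Rightarrow> 'v list \<Rightarrow> bool" where
  "is_cycle E us \<longleftrightarrow> 3 \<le> length us \<and> distinct us \<and> cycle_arcs us \<subseteq> E"

text \<open>Out-degree at most one is expressed separately, as \<open>single_valued R\<close>;
  in-degrees are read off from the converse of \<open>R\<close>.\<close>

definition orientation :: "('v \<times> 'v) set \<Rightarrow> ('v \<times> 'v) set \<Rightarrow> bool" where
  "orientation E R \<longleftrightarrow> E = R \<union> R\<inverse> \<and> R \<inter> R\<inverse> = {}"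

lemma cycle_graph_iff:
  "cycle_graph C \<longleftrightarrow>
     (\<exists>us. 3 \<le> length us \<and> distinct us \<and> pverts C = set us \<and> parcs C = cycle_arcs us)"
  by (simp add: cycle_graph_def cycle_arcs_def)

lemma cycle_arcs_subset_set: "cycle_arcs us \<subseteq> set us \<times> set us"
proof -
  have "us ! (Suc i mod length us) \<in> set us" if "i < length us" for i
  proof -
    from that have "0 < length us" by linarith
    then show ?thesis by (intro nth_mem mod_less_divisor)
  qed
  then show ?thesis by (auto simp: cycle_arcs_def)
qed

text \<open>The neighbours of \<open>us ! i\<close> are its cyclic successor and predecessor, which
  differ because there are at least three positions.\<close>

lemma card_cycle_neighbours:
  assumes "3 \<le> length us" "distinct us" "v \<in> set us"
  shows "card (cycle_arcs us `` {v}) = 2"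
proof -
  let ?n = "length us"
  from assms(3) obtain i where i: "i < ?n" "v = us ! i" by (auto simp: in_set_conv_nth)
  define s where "s = Suc i mod ?n"
  \<comment> \<open>The cyclic predecessor of \<open>i\<close>; truncated subtraction would send
    position 0 to itself.\<close>
  define q where "q = (if i = 0 then ?n - 1 else i - 1)"
  have sq: "s < ?n" "q < ?n" "s \<noteq> q"
    using i assms(1) by (auto simp: s_def q_def mod_Suc)
  have Suc_q: "Suc j mod ?n = i \<longleftrightarrow> j = q" if "j < ?n" for j
    using that i assms(1) by (auto simp: q_def mod_Suc)
  have lt: "Suc j mod ?n < ?n" for j
    using i(1) by (intro mod_less_divisor) linarith
  have inj: "us ! a = us ! b \<longleftrightarrow> a = b" if "a < ?n" "b < ?n" for a b
    using assms(2) that by (simp add: nth_eq_iff_index_eq)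
  have "cycle_arcs us `` {v} = {us ! s, us ! q}"
  proof (intro equalityI subsetI)
    fix w assume "w \<in> cycle_arcs us `` {v}"
    then obtain j where j: "j < ?n"
      and "(us ! i = us ! j \<and> w = us ! (Suc j mod ?n)) \<or>
        (us ! i = us ! (Suc j mod ?n) \<and> w = us ! j)"
      by (auto simp: cycle_arcs_def i(2))
    then have "(i = j \<and> w = us ! (Suc j mod ?n)) \<or> (i = Suc j mod ?n \<and> w = us ! j)"
      using inj i(1) lt by metis
    then show "w \<in> {us ! s, us ! q}" using Suc_q[OF j] by (auto simp: s_def)
  next
    have "us ! s \<in> cycle_arcs us `` {v}"
      using i by (auto simp: cycle_arcs_def s_def)
    moreover have "us ! q \<in> cycle_arcs us `` {v}"
      using i Suc_q[OF sq(2)] sq(2) by (fastforce simp: cycle_arcs_def)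
    ultimately show "w \<in> cycle_arcs us `` {v}" if "w \<in> {us ! s, us ! q}" for w
      using that by auto
  qed
  then show ?thesis using sq inj[OF sq(1,2)] by simp
qed

section \<open>Leaves of finite acyclic graphs\<close>

text \<open>A chord from the start of a path to position \<open>k\<close> closes the first
  \<open>Suc k\<close> vertices into a cycle; \<open>2 \<le> k\<close> excludes the first arc of the
  path and provides three vertices.\<close>

lemma is_cycle_if_path_closes:
  assumes "sym E" "distinct us" "successively (\<lambda>x y. (x, y) \<in> E) us"
    and k: "2 \<le> k" "k < length us" and "(us ! 0, us ! k) \<in> E"
  shows "is_cycle E (take (Suc k) us)"
proof -
  have step: "(us ! i, us ! Suc i) \<in> E" if "i < k" for i
    using assms(3) k that by (auto simp: successively_conv_nth)
  have "(us ! i, us ! (Suc i mod Suc k)) \<in> E" if "i \<le> k" for i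
    using step[of i] that assms(1,6) by (cases "i = k") (auto dest: symD)
  moreover from this have "(us ! (Suc i mod Suc k), us ! i) \<in> E" if "i \<le> k" for i
    using that assms(1) by (blast dest: symD)
  moreover have "length (take (Suc k) us) = Suc k" using k by simp
  ultimately have "cycle_arcs (take (Suc k) us) \<subseteq> E"
    unfolding cycle_arcs_def by (auto simp: less_Suc_eq_le)
  then show ?thesis using assms(2) k by (simp add: is_cycle_def)
qed

text \<open>An end of a longest path is a leaf, and a longest path has two distinct ends, so one of
  them avoids \<open>r\<close>.\<close>

lemma acyclic_leaf_avoiding:
  assumes "finite E" "sym E" "irrefl E" "E \<noteq> {}" "\<nexists>us. is_cycle E us"
  obtains v w where "v \<noteq> r" "E `` {v} = {w}"
proof -
  let ?S = "successively (\<lambda>x y. (x, y) \<in> E)"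
  let ?P = "\<lambda>us. distinct us \<and> ?S us \<and> 2 \<le> length us"
  \<comment> \<open>This bound guarantees a longest path. With at least two vertices, each vertex of
    a path lies on an arc, hence in the field of \<open>E\<close>.\<close>
  have len: "length us \<le> card (Field E)" if "?P us" for us
  proof -
    have "us ! i \<in> Field E" if "i < length us" for i
    proof (cases i)
      case 0
      then have "(us ! 0, us ! Suc 0) \<in> E"
        using \<open>?P us\<close> by (auto simp: successively_conv_nth)
      then show ?thesis using 0 by (auto simp: Field_def)
    next
      case (Suc j)
      then have "(us ! j, us ! Suc j) \<in> E"
        using \<open>?P us\<close> that by (auto simp: successively_conv_nth)
      then show ?thesis using Suc by (auto simp: Field_def)
    qed
    then have "set us \<subseteq> Field E" by (auto simp: in_set_conv_nth)
    then have "card (set us) \<le> card (Field E)"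
      using assms(1) by (intro card_mono finite_Field)
    then show ?thesis using that by (simp add: distinct_card)
  qed
  from assms(4) obtain a b where "(a, b) \<in> E" by auto
  with assms(3) have "?P [a, b]" by (auto simp: irrefl_def)
  moreover have "\<forall>us. ?P us \<longrightarrow> length us < Suc (card (Field E))"
    using len by (simp add: less_Suc_eq_le)
  ultimately have "\<exists>us. ?P us \<and> (\<forall>ws. ?P ws \<longrightarrow> length ws \<le> length us)"
    by (rule ex_has_greatest_nat)
  then obtain us0 where us0: "?P us0" "\<And>ws. ?P ws \<Longrightarrow> length ws \<le> length us0" by blast
  have "\<exists>us. ?P us \<and> length us = length us0 \<and> hd us \<noteq> r"
  proof (cases "hd us0 = r")
    case True
    have "hd (rev us0) \<noteq> r"
    proof -
      have "us0 ! 0 \<noteq> us0 ! (length us0 - 1)"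
        using us0(1) by (subst nth_eq_iff_index_eq) auto
      then show ?thesis using True us0(1)
        by (cases "us0 = []") (auto simp: hd_rev last_conv_nth hd_conv_nth)
    qed
    moreover have "?P (rev us0)"
      using us0(1) assms(2) by (auto elim!: successively_mono dest: symD)
    ultimately show ?thesis by (intro exI[of _ "rev us0"]) simp
  qed (use us0 in blast)
  then obtain us where us: "?P us" "hd us \<noteq> r" "length us = length us0" by blast
  then obtain v w ws where uw: "us = v # w # ws"
    by (cases us rule: remdups_adj.cases) auto
  \<comment> \<open>A neighbour of \<open>v\<close> off the path would extend it, one at position 2
    or later would close a cycle, and position 0 would be a loop; only position 1 is left.\<close>
  have "w' = w" if w': "(v, w') \<in> E" for w'
  proof -
    have "w' \<in> set us"
    proof (rule ccontr)
      assume "w' \<notin> set us"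
      then have "?P (w' # us)" using us(1) w' assms(2) uw by (auto dest: symD)
      then show False using us0(2)[of "w' # us"] us(3) by simp
    qed
    then obtain k where k: "k < length us" "us ! k = w'" by (auto simp: in_set_conv_nth)
    moreover have "k \<noteq> 0"
    proof
      assume "k = 0"
      then have "w' = v" using k(2) uw by simp
      then show False using w' assms(3) by (simp add: irrefl_def)
    qed
    moreover have "\<not> 2 \<le> k"
    proof
      assume "2 \<le> k"
      moreover have "(us ! 0, us ! k) \<in> E" using k(2) w' uw by simp
      ultimately have "is_cycle E (take (Suc k) us)"
        using us(1) k(1) assms(2) by (intro is_cycle_if_path_closes) simp_all
      then show False using assms(5) by blast
    qed
    ultimately have "k = 1" by linarith
    then show ?thesis using k(2) uw by simp
  qed
  moreover have "(v, w) \<in> E" using us(1) uw by simp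
  ultimately have "E `` {v} = {w}" by blast
  moreover have "v \<noteq> r" using us(2) uw by simp
  ultimately show thesis by (rule that[rotated])
qed

section \<open>Orientations with out-degree at most one\<close>

lemma is_cycle_mono: "is_cycle E us \<Longrightarrow> E \<subseteq> F \<Longrightarrow> is_cycle F us"
  by (auto simp: is_cycle_def)

lemma orientation_insert:
  assumes "orientation (E - {(v, w), (w, v)}) R" "(v, w) \<in> E" "(w, v) \<in> E" "v \<noteq> w"
  shows "orientation E (insert (v, w) R)"
  using assms unfolding orientation_def by blast

text \<open>Once the only edge at a leaf \<open>v\<close> is deleted, \<open>v\<close> is outside
  the domain of the remaining orientation, so the arc leaving \<open>v\<close> can be added. Keeping
  \<open>r\<close> out of the domain reserves an outgoing arc at \<open>r\<close> for the edge that
  closes a cycle.\<close>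

lemma acyclic_orientation:
  assumes "finite E" "sym E" "irrefl E" "\<nexists>us. is_cycle E us"
  shows "\<exists>R. orientation E R \<and> single_valued R \<and> r \<notin> Domain R"
  using assms
proof (induction "card E" arbitrary: E rule: less_induct)
  case less
  show ?case
  proof (cases "E = {}")
    case True
    then show ?thesis by (intro exI[of _ "{}"]) (auto simp: orientation_def)
  next
    case False
    then obtain v w where vw: "v \<noteq> r" "E `` {v} = {w}"
      using acyclic_leaf_avoiding less.prems by metis
    let ?E = "E - {(v, w), (w, v)}"
    have arcs: "(v, w) \<in> E" "(w, v) \<in> E" "v \<noteq> w"
      using vw(2) less.prems(2,3) by (auto simp: irrefl_def dest: symD)
    have "card ?E < card E" using arcs less.prems(1) by (intro psubset_card_mono) auto
    moreover have "sym ?E" using less.prems(2) by (auto simp: sym_def)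
    moreover have "irrefl ?E" using less.prems(3) by (auto simp: irrefl_def)
    moreover have "\<nexists>us. is_cycle ?E us" using less.prems(4) is_cycle_mono by (metis Diff_subset)
    ultimately obtain R where R: "orientation ?E R" "single_valued R" "r \<notin> Domain R"
      using less.hyps[of ?E] less.prems(1) by auto
    have "v \<notin> Domain R" using R(1) vw(2) by (auto simp: orientation_def)
    then have "single_valued (insert (v, w) R)" using R(2) by (auto simp: single_valued_def)
    then show ?thesis
      using orientation_insert[OF R(1) arcs] R(3) vw(1) by (intro exI[of _ "insert (v, w) R"]) auto
  qed
qed

text \<open>Uniqueness is stated through arc sets because one cycle is listed by many
  \<open>us\<close>, one for each starting vertex and direction. A cycle surviving the deletion of
  an edge of \<open>us\<close> would have the same arcs as \<open>us\<close>, the deleted ones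
  included.\<close>

lemma unicyclic_orientation:
  assumes "finite E" "sym E" "irrefl E"
    and "\<And>us ws. is_cycle E us \<Longrightarrow> is_cycle E ws \<Longrightarrow> cycle_arcs us = cycle_arcs ws"
  shows "\<exists>R. orientation E R \<and> single_valued R"
proof (cases "\<exists>us. is_cycle E us")
  case True
  then obtain us where us: "is_cycle E us" by blast
  define v w where "v = us ! 0" and "w = us ! 1"
  have vw: "(v, w) \<in> cycle_arcs us"
    using us by (auto simp: is_cycle_def cycle_arcs_def v_def w_def intro!: bexI[of _ 0])
  let ?E = "E - {(v, w), (w, v)}"
  have arcs: "(v, w) \<in> E" "(w, v) \<in> E" "v \<noteq> w"
    using us vw assms(2,3) by (auto simp: is_cycle_def irrefl_def dest: symD)
  have "\<nexists>ws. is_cycle ?E ws"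
  proof
    assume "\<exists>ws. is_cycle ?E ws"
    then obtain ws where ws: "is_cycle ?E ws" by blast
    then have "cycle_arcs us = cycle_arcs ws" by (intro assms(4) us is_cycle_mono[OF ws]) auto
    then show False using ws vw by (auto simp: is_cycle_def)
  qed
  moreover have "sym ?E" using assms(2) by (auto simp: sym_def)
  moreover have "irrefl ?E" using assms(3) by (auto simp: irrefl_def)
  ultimately obtain R where R: "orientation ?E R" "single_valued R" "v \<notin> Domain R"
    using acyclic_orientation[of ?E v] assms(1) by auto
  then have "single_valued (insert (v, w) R)" by (auto simp: single_valued_def)
  then show ?thesis using orientation_insert[OF R(1) arcs] by blast
qed (use acyclic_orientation[OF assms(1-3)] in blast)

section \<open>Connected 2-regular graphs\<close>

text \<open>Without a cycle there would be a leaf, against degree 2. On a cycle every vertex already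
  has its two neighbours there, so the cycle is closed under adjacency and is the whole
  graph.\<close>

lemma connected_2_regular_is_cycle:
  assumes "finite E" "sym E" "irrefl E" "E \<subseteq> V \<times> V" "V \<noteq> {}"
    and conn: "\<And>S. S \<noteq> {} \<Longrightarrow> S \<subseteq> V \<Longrightarrow> E `` S \<subseteq> S \<Longrightarrow> S = V"
    and deg: "\<And>v. v \<in> V \<Longrightarrow> card (E `` {v}) = 2"
  obtains us where "3 \<le> length us" "distinct us" "V = set us" "E = cycle_arcs us"
proof -
  have "\<exists>us. is_cycle E us"
  proof (rule ccontr)
    assume "\<nexists>us. is_cycle E us"
    moreover have "E \<noteq> {}" using deg assms(5) by fastforce
    ultimately obtain v w where vw: "E `` {v} = {w}"
      using acyclic_leaf_avoiding[OF assms(1-3)] by metis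
    then have "v \<in> V" using assms(4) by auto
    then show False using deg vw by force
  qed
  then obtain us where us: "3 \<le> length us" "distinct us" "cycle_arcs us \<subseteq> E"
    by (auto simp: is_cycle_def)
  have V: "set us \<subseteq> V"
  proof
    fix v assume "v \<in> set us"
    then have "card (cycle_arcs us `` {v}) = 2" using us card_cycle_neighbours by metis
    then have "cycle_arcs us `` {v} \<noteq> {}" by force
    then show "v \<in> V" using us(3) assms(4) by auto
  qed
  have nb: "E `` {v} = cycle_arcs us `` {v}" if "v \<in> set us" for v
  proof (rule sym, rule card_subset_eq)
    show "finite (E `` {v})" using assms(1) by simp
    show "cycle_arcs us `` {v} \<subseteq> E `` {v}" using us(3) by auto
    show "card (cycle_arcs us `` {v}) = card (E `` {v})"
      using card_cycle_neighbours[OF us(1,2) that] deg that V by auto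
  qed
  have "E `` set us \<subseteq> set us"
  proof
    fix w assume "w \<in> E `` set us"
    then obtain v where "v \<in> set us" "w \<in> E `` {v}" by auto
    then show "w \<in> set us" using nb cycle_arcs_subset_set[of us] by auto
  qed
  then have "set us = V" using V us(1) by (intro conn) auto
  moreover have "E = cycle_arcs us"
  proof
    show "E \<subseteq> cycle_arcs us"
    proof
      fix e assume "e \<in> E"
      moreover then have "fst e \<in> set us" using assms(4) \<open>set us = V\<close> by auto
      ultimately show "e \<in> cycle_arcs us" using nb[of "fst e"] by (cases e) auto
    qed
  qed (rule us(3))
  ultimately show thesis using us that by blast
qed

section \<open>Real eigenvalues, and the eigenvalue equation at a vertex\<close>

text \<open>A complex eigenvalue \<open>k\<close> exists. The Hermitian form \<open>Q\<close> of its
  eigenvector equals \<open>k\<close> times the squared norm \<open>N\<close>, and by symmetry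
  conjugation only swaps the two sums, so \<open>k\<close> is real and a root of the real
  characteristic polynomial.\<close>

lemma symmetric_real_spectrum_nonempty:
  fixes A :: "real mat"
  assumes A: "A \<in> carrier_mat n n" and "n > 0"
    and symA: "\<And>i j. i < n \<Longrightarrow> j < n \<Longrightarrow> A $$ (i, j) = A $$ (j, i)"
  shows "spectrum A \<noteq> {}"
proof -
  let ?c = "complex_of_real"
  let ?A = "map_mat ?c A"
  have cA: "?A \<in> carrier_mat n n" using A by simp
  obtain k where k: "eigenvalue ?A k"
    using spectrum_non_empty[OF cA \<open>n > 0\<close>] by (auto simp: spectrum_def)
  then obtain x where x: "x \<in> carrier_vec n" "x \<noteq> 0\<^sub>v n" "?A *\<^sub>v x = k \<cdot>\<^sub>v x"
    using A by (auto simp: eigenvalue_def eigenvector_def)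
  have row: "(\<Sum>j<n. ?c (A $$ (i, j)) * x $ j) = k * x $ i" if "i < n" for i
  proof -
    have "(?A *\<^sub>v x) $ i = (\<Sum>j<n. ?c (A $$ (i, j)) * x $ j)"
      using that A x(1) by (auto simp: scalar_prod_def atLeast0LessThan intro!: sum.cong)
    then show ?thesis using x(1,3) that by simp
  qed
  define N where "N = (\<Sum>i<n. (cmod (x $ i))\<^sup>2)"
  have "N \<noteq> 0"
  proof
    assume "N = 0"
    then have "x $ i = 0" if "i < n" for i
      using that by (simp add: N_def sum_nonneg_eq_0_iff)
    then show False using x(1,2) by (auto intro!: eq_vecI)
  qed
  define Q where "Q = (\<Sum>i<n. \<Sum>j<n. cnj (x $ i) * (?c (A $$ (i, j)) * x $ j))"
  have "Q = (\<Sum>i<n. cnj (x $ i) * (k * x $ i))"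
    unfolding Q_def by (intro sum.cong refl) (simp add: sum_distrib_left[symmetric] row)
  also have "\<dots> = k * ?c N"
    unfolding N_def of_real_sum sum_distrib_left
    by (intro sum.cong refl) (simp only: complex_norm_square mult_ac)
  finally have Q: "Q = k * ?c N" .
  have "cnj Q = (\<Sum>i<n. \<Sum>j<n. cnj (x $ j) * (?c (A $$ (j, i)) * x $ i))"
    by (simp add: Q_def symA mult_ac)
  also have "\<dots> = Q" unfolding Q_def by (rule sum.swap)
  finally have "cnj k = k" using Q \<open>N \<noteq> 0\<close> by simp
  then have "k = ?c (Re k)" by (simp add: complex_eq_iff)
  then have "poly (map_poly ?c (char_poly A)) (?c (Re k)) = 0"
    using k eigenvalue_root_char_poly[OF cA] of_real_hom.char_poly_hom[OF A] by metis
  then have "poly (char_poly A) (Re k) = 0" by simp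
  then show ?thesis using spectrum_root_char_poly[OF A] by auto
qed

lemma A_alpha_carrier: "A_alpha \<alpha> G vs \<in> carrier_mat (length vs) (length vs)"
  by (simp add: A_alpha_def degree_mat_def adjacency_mat_def)

lemma degree_of_eq: "degree_of G v = card (parcs G `` {v})"
proof -
  have "out_arcs (with_proj G) v = Pair v ` (parcs G `` {v})" by (auto simp: out_arcs_def)
  then show ?thesis
    by (simp add: degree_of_def out_degree_def card_image inj_on_def)
qed

lemma A_alpha_mult_vec:
  assumes "enumerates_verts vs G" "parcs G \<subseteq> pverts G \<times> pverts G" and i: "i < length vs"
  shows "(A_alpha \<alpha> G vs *\<^sub>v vec (length vs) (\<lambda>j. f (vs ! j))) $ i =
    \<alpha> * real (degree_of G (vs ! i)) * f (vs ! i) + (1 - \<alpha>) * (\<Sum>u\<in>parcs G `` {vs ! i}. f u)"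
proof -
  let ?n = "length vs" and ?v = "vs ! i"
  have vs: "distinct vs" "set vs = pverts G" using assms(1) by (auto simp: enumerates_verts_def)
  have "(\<Sum>j<?n. (if (?v, vs ! j) \<in> parcs G then f (vs ! j) else 0)) =
      (\<Sum>u\<in>pverts G. if (?v, u) \<in> parcs G then f u else 0)"
    using sum.reindex_bij_betw[OF bij_betw_nth[OF vs(1) refl refl],
      of "\<lambda>u. if (?v, u) \<in> parcs G then f u else 0"] vs(2) by simp
  also have "\<dots> = (\<Sum>u\<in>pverts G \<inter> {u. (?v, u) \<in> parcs G}. f u)"
    using vs(2)[symmetric] by (simp add: sum.inter_restrict)
  also have "pverts G \<inter> {u. (?v, u) \<in> parcs G} = parcs G `` {?v}" using assms(2) by auto
  finally have adj: "(\<Sum>j<?n. (if (?v, vs ! j) \<in> parcs G then f (vs ! j) else 0)) =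
      (\<Sum>u\<in>parcs G `` {?v}. f u)" .
  have "(A_alpha \<alpha> G vs *\<^sub>v vec ?n (\<lambda>j. f (vs ! j))) $ i =
      (\<Sum>j<?n. (\<alpha> * (if i = j then real (degree_of G ?v) else 0)
        + (1 - \<alpha>) * (if (?v, vs ! j) \<in> parcs G then 1 else 0)) * f (vs ! j))"
    using i by (simp add: A_alpha_def degree_mat_def adjacency_mat_def scalar_prod_def
      atLeast0LessThan)
  also have "\<dots> = (\<Sum>j<?n. (if i = j then \<alpha> * real (degree_of G ?v) * f ?v else 0)
        + (1 - \<alpha>) * (if (?v, vs ! j) \<in> parcs G then f (vs ! j) else 0))"
    by (intro sum.cong refl) (auto simp: algebra_simps)
  also have "\<dots> = \<alpha> * real (degree_of G ?v) * f ?v + (1 - \<alpha>) * (\<Sum>u\<in>parcs G `` {?v}. f u)"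
    using i by (simp only: sum.distrib sum_distrib_left[symmetric] adj) simp
  finally show ?thesis .
qed

text \<open>Replaces vectors indexed by positions with functions on vertices, so that the estimates
  below involve only the arc relation and not the enumeration.\<close>

lemma eigenvalue_A_alpha_iff:
  assumes "enumerates_verts vs G" "parcs G \<subseteq> pverts G \<times> pverts G"
  shows "eigenvalue (A_alpha \<alpha> G vs) k \<longleftrightarrow>
    (\<exists>f. (\<exists>v\<in>pverts G. f v \<noteq> 0) \<and> (\<forall>v\<in>pverts G.
       \<alpha> * real (degree_of G v) * f v + (1 - \<alpha>) * (\<Sum>u\<in>parcs G `` {v}. f u) = k * f v))"
proof -
  let ?n = "length vs" and ?A = "A_alpha \<alpha> G vs"
  let ?x = "\<lambda>f. vec (length vs) (\<lambda>j. f (vs ! j))"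
  have vs: "distinct vs" "pverts G = set vs" using assms(1) by (auto simp: enumerates_verts_def)
  have ev: "eigenvector ?A (?x f) k \<longleftrightarrow> (\<exists>v\<in>pverts G. f v \<noteq> 0) \<and> (\<forall>v\<in>pverts G.
       \<alpha> * real (degree_of G v) * f v + (1 - \<alpha>) * (\<Sum>u\<in>parcs G `` {v}. f u) = k * f v)" for f
  proof -
    have "?x f \<noteq> 0\<^sub>v ?n \<longleftrightarrow> (\<exists>v\<in>pverts G. f v \<noteq> 0)"
      by (simp add: vec_eq_iff vs(2) Bex_set list_ex_length)
    moreover have "?A *\<^sub>v ?x f = k \<cdot>\<^sub>v ?x f \<longleftrightarrow> (\<forall>i<?n. (?A *\<^sub>v ?x f) $ i = k * f (vs ! i))"
      using A_alpha_carrier[of \<alpha> G vs] by (auto simp: vec_eq_iff)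
    moreover have "\<dots> \<longleftrightarrow> (\<forall>v\<in>pverts G.
       \<alpha> * real (degree_of G v) * f v + (1 - \<alpha>) * (\<Sum>u\<in>parcs G `` {v}. f u) = k * f v)"
      using A_alpha_mult_vec[OF assms] by (auto simp: vs(2) all_set_conv_all_nth)
    ultimately show ?thesis
      using A_alpha_carrier[of \<alpha> G vs] by (auto simp: eigenvector_def)
  qed
  \<comment> \<open>Each vertex receives the entry at its position in \<open>vs\<close>, which is
    unique because \<open>vs\<close> is distinct.\<close>
  have "\<exists>f. x = ?x f" if "x \<in> carrier_vec ?n" for x :: "real vec"
  proof -
    have "bij_betw ((!) vs) {..<?n} (set vs)" using bij_betw_nth[OF vs(1) refl refl] .
    then have "the_inv_into {..<?n} ((!) vs) (vs ! i) = i" if "i < ?n" for i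
      using that by (auto simp: bij_betw_def intro: the_inv_into_f_f)
    then show ?thesis
      using that by (intro exI[of _ "\<lambda>v. x $ the_inv_into {..<?n} ((!) vs) v"])
        (auto intro!: eq_vecI)
  qed
  then have "\<exists>f. x = ?x f" if "eigenvector ?A x k" for x
    using that A_alpha_carrier[of \<alpha> G vs] by (simp add: eigenvector_def)
  then have "eigenvalue ?A k \<longleftrightarrow> (\<exists>f. eigenvector ?A (?x f) k)"
    unfolding eigenvalue_def by metis
  then show ?thesis by (simp only: ev)
qed

text \<open>The maximum of an empty set is unspecified, so \<^const>\<open>rho_alpha\<close> is meaningful only once a
  real eigenvalue is known to exist.\<close>

lemma spectrum_A_alpha:
  assumes "sym (parcs G)" "vs \<noteq> []"
  shows "finite (spectrum (A_alpha \<alpha> G vs))" "spectrum (A_alpha \<alpha> G vs) \<noteq> {}"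
proof -
  show "finite (spectrum (A_alpha \<alpha> G vs))"
    by (rule card_finite_spectrum(1)[OF A_alpha_carrier])
  show "spectrum (A_alpha \<alpha> G vs) \<noteq> {}"
    using assms by (intro symmetric_real_spectrum_nonempty[OF A_alpha_carrier])
      (auto simp: A_alpha_def degree_mat_def adjacency_mat_def dest: symD)
qed

section \<open>The quadratic form along an orientation\<close>

text \<open>The slack in the eigenvalue bound, written as a sum of terms that are all nonnegative under
  the degree conditions.\<close>

lemma orientation_gap:
  fixes f :: "'v \<Rightarrow> real" and \<alpha> s \<Delta> k :: real
  assumes V: "finite V" and E: "E \<subseteq> V \<times> V" and R: "orientation E R" and s: "s > 0"
    and eq: "\<And>v. v \<in> V \<Longrightarrow>
      \<alpha> * real (card (E `` {v})) * f v + (1 - \<alpha>) * (\<Sum>u\<in>E `` {v}. f u) = k * f v"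
  shows "(\<alpha> * \<Delta> + 2 * (1 - \<alpha>) * s - k) * (\<Sum>v\<in>V. (f v)\<^sup>2) =
      (\<Sum>v\<in>V. (\<alpha> * (\<Delta> - real (card (E `` {v}))) + (1 - \<alpha>) *
         (2 * s - s * real (card (R `` {v})) - real (card (R\<inverse> `` {v})) / s)) * (f v)\<^sup>2)
      + (1 - \<alpha>) * (\<Sum>(v, u)\<in>R. (s * f v - f u)\<^sup>2 / s)"
proof -
  have RE: "R \<subseteq> V \<times> V" "R\<inverse> \<subseteq> V \<times> V" using R E by (auto simp: orientation_def)
  have fin: "finite E" "finite R" "finite (R\<inverse>)"
    using V E RE by (auto intro: finite_subset[OF _ finite_cartesian_product])
  \<comment> \<open>Groups a sum over arcs by their tails; applied to the converse of
    \<open>R\<close>, it groups the arcs of \<open>R\<close> by their heads.\<close>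
  have fib: "(\<Sum>v\<in>V. \<Sum>u\<in>T `` {v}. g v u) = (\<Sum>(v, u)\<in>T. g v u)"
    if "T \<subseteq> V \<times> V" for T and g :: "'v \<Rightarrow> 'v \<Rightarrow> real"
  proof -
    have "finite (T `` {v})" for v
      using that V by (auto intro!: finite_Image finite_subset[OF that])
    then have "(\<Sum>v\<in>V. \<Sum>u\<in>T `` {v}. g v u) = (\<Sum>(v, u)\<in>Sigma V (\<lambda>v. T `` {v}). g v u)"
      using V by (intro sum.Sigma) auto
    also have "Sigma V (\<lambda>v. T `` {v}) = T" using that by auto
    finally show ?thesis .
  qed
  have conv: "(\<Sum>(v, u)\<in>R\<inverse>. g v u) = (\<Sum>(v, u)\<in>R. g u v)" for g :: "'v \<Rightarrow> 'v \<Rightarrow> real"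
    by (rule sum.reindex_bij_witness[of _ prod.swap prod.swap]) auto
  have "(\<Sum>v\<in>V. f v * (\<Sum>u\<in>E `` {v}. f u)) = (\<Sum>(v, u)\<in>E. f v * f u)"
    using fib[OF E] by (simp add: sum_distrib_left)
  also have "\<dots> = (\<Sum>(v, u)\<in>R. f v * f u) + (\<Sum>(v, u)\<in>R\<inverse>. f v * f u)"
    using R fin by (auto simp: orientation_def intro: sum.union_disjoint)
  also have "\<dots> = (\<Sum>(v, u)\<in>R. 2 * f v * f u)"
    unfolding conv sum.distrib[symmetric] by (intro sum.cong refl) auto
  finally have quad: "(\<Sum>v\<in>V. f v * (\<Sum>u\<in>E `` {v}. f u)) = (\<Sum>(v, u)\<in>R. 2 * f v * f u)" .
  have "(\<Sum>(v, u)\<in>R. s * (f v)\<^sup>2) = (\<Sum>v\<in>V. s * real (card (R `` {v})) * (f v)\<^sup>2)"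
    using fib[OF RE(1), of "\<lambda>v u. s * (f v)\<^sup>2"] by (simp add: mult_ac)
  moreover have "(\<Sum>(v, u)\<in>R. (f u)\<^sup>2 / s) = (\<Sum>v\<in>V. real (card (R\<inverse> `` {v})) / s * (f v)\<^sup>2)"
    using fib[OF RE(2), of "\<lambda>v u. (f v)\<^sup>2 / s"] conv[of "\<lambda>v u. (f v)\<^sup>2 / s"] by simp
  \<comment> \<open>Completing the square keeps the defect of the edge estimate, which later decides
    the equality case.\<close>
  moreover have "(\<Sum>(v, u)\<in>R. (s * f v - f u)\<^sup>2 / s) =
      (\<Sum>(v, u)\<in>R. s * (f v)\<^sup>2) + (\<Sum>(v, u)\<in>R. (f u)\<^sup>2 / s) - (\<Sum>(v, u)\<in>R. 2 * f v * f u)"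
    unfolding sum.distrib[symmetric] sum_subtractf[symmetric]
    using s by (intro sum.cong refl) (auto simp: field_simps power2_eq_square)
  ultimately have sq: "(\<Sum>(v, u)\<in>R. (s * f v - f u)\<^sup>2 / s) =
      (\<Sum>v\<in>V. (s * real (card (R `` {v})) + real (card (R\<inverse> `` {v})) / s) * (f v)\<^sup>2)
      - (\<Sum>v\<in>V. f v * (\<Sum>u\<in>E `` {v}. f u))"
    by (simp add: quad sum.distrib distrib_right)
  have "k * (\<Sum>v\<in>V. (f v)\<^sup>2) = (\<Sum>v\<in>V. f v * (k * f v))"
    by (simp add: sum_distrib_left power2_eq_square mult_ac)
  also have "\<dots> = (\<Sum>v\<in>V. f v *
      (\<alpha> * real (card (E `` {v})) * f v + (1 - \<alpha>) * (\<Sum>u\<in>E `` {v}. f u)))"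
    using eq by simp
  also have "\<dots> = (\<Sum>v\<in>V. \<alpha> * real (card (E `` {v})) * (f v)\<^sup>2)
      + (1 - \<alpha>) * (\<Sum>v\<in>V. f v * (\<Sum>u\<in>E `` {v}. f u))"
    unfolding sum_distrib_left sum.distrib[symmetric]
    by (intro sum.cong refl) (simp add: distrib_left power2_eq_square sum_distrib_left mult_ac)
  finally have k: "k * (\<Sum>v\<in>V. (f v)\<^sup>2) = (\<Sum>v\<in>V. \<alpha> * real (card (E `` {v})) * (f v)\<^sup>2)
      + (1 - \<alpha>) * (\<Sum>v\<in>V. f v * (\<Sum>u\<in>E `` {v}. f u))" .
  have "(\<Sum>v\<in>V. (\<alpha> * (\<Delta> - real (card (E `` {v}))) + (1 - \<alpha>) *
         (2 * s - s * real (card (R `` {v})) - real (card (R\<inverse> `` {v})) / s)) * (f v)\<^sup>2) =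
      (\<Sum>v\<in>V. (\<alpha> * \<Delta> + 2 * (1 - \<alpha>) * s) * (f v)\<^sup>2 - \<alpha> * real (card (E `` {v})) * (f v)\<^sup>2 - (1 - \<alpha>) *
         ((s * real (card (R `` {v})) + real (card (R\<inverse> `` {v})) / s) * (f v)\<^sup>2))"
    by (intro sum.cong refl) (simp add: algebra_simps)
  then show ?thesis
    unfolding left_diff_distrib k sq right_diff_distrib sum_subtractf
    by (simp add: sum_distrib_left[symmetric])
qed

lemma card_orientation_neighbours:
  assumes "orientation E R" "finite E"
  shows "card (E `` {v}) = card (R `` {v}) + card (R\<inverse> `` {v})"
proof -
  have "finite R" using assms by (auto simp: orientation_def)
  moreover have "E `` {v} = R `` {v} \<union> R\<inverse> `` {v}" "R `` {v} \<inter> R\<inverse> `` {v} = {}"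
    using assms(1) by (auto simp: orientation_def)
  ultimately show ?thesis by (simp add: card_Un_disjoint)
qed

lemma card_single_valued:
  assumes "single_valued R"
  shows "card (R `` {v}) \<le> 1"
proof (cases "R `` {v} = {}")
  case False
  then obtain u where "(v, u) \<in> R" by blast
  with assms have "R `` {v} = {u}" by (blast dest: single_valuedD)
  then show ?thesis by simp
qed simp

text \<open>All terms on the right of the gap identity are nonnegative, so for \<open>k = b\<close>
  each vanishes: the squares along the arcs and, where \<open>f\<close> is nonzero, the slack of the
  vertex weight. The last conclusion is this slack multiplied by \<open>s\<close> and moved to
  natural numbers.\<close>

lemma oriented_eigenvalue_bound:
  fixes f :: "'v \<Rightarrow> real" and \<alpha> k :: real and \<Delta> :: nat
  defines "b \<equiv> \<alpha> * real \<Delta> + 2 * (1 - \<alpha>) * sqrt (real \<Delta> - 1)"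
  assumes V: "finite V" and E: "E \<subseteq> V \<times> V" and R: "orientation E R" "single_valued R"
    and \<Delta>: "\<Delta> \<ge> 2" "\<And>v. v \<in> V \<Longrightarrow> card (E `` {v}) \<le> \<Delta>"
    and \<alpha>: "0 \<le> \<alpha>" "\<alpha> \<le> 1"
    and eq: "\<And>v. v \<in> V \<Longrightarrow>
      \<alpha> * real (card (E `` {v})) * f v + (1 - \<alpha>) * (\<Sum>u\<in>E `` {v}. f u) = k * f v"
    and nz: "\<exists>v\<in>V. f v \<noteq> 0"
  shows "k \<le> b"
    and "k = b \<Longrightarrow> \<alpha> < 1 \<Longrightarrow> (v, u) \<in> R \<Longrightarrow> f v = 0 \<longleftrightarrow> f u = 0"
    and "k = b \<Longrightarrow> \<alpha> < 1 \<Longrightarrow> v \<in> V \<Longrightarrow> f v \<noteq> 0 \<Longrightarrow>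
      (\<Delta> - 1) * card (R `` {v}) + card (R\<inverse> `` {v}) = 2 * (\<Delta> - 1)"
proof -
  define s where "s = sqrt (real \<Delta> - 1)"
  have s: "s > 0" "s * s = real \<Delta> - 1" using \<Delta>(1) by (auto simp: s_def)
  have finE: "finite E" using V E by (auto intro: finite_subset)
  have finR: "finite R" using finE R by (auto simp: orientation_def)
  define c where "c v = 2 * s - s * real (card (R `` {v})) - real (card (R\<inverse> `` {v})) / s" for v
  \<comment> \<open>The factor \<open>s\<close> removes both the root and the division, so the sign
    of \<open>c v\<close> becomes a question about natural numbers.\<close>
  have sc: "s * c v = 2 * (real \<Delta> - 1)
      - (real \<Delta> - 1) * real (card (R `` {v})) - real (card (R\<inverse> `` {v}))"
    for v unfolding s(2)[symmetric] c_def using s(1) by (simp add: field_simps)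
  have c: "c v \<ge> 0" if "v \<in> V" for v
  proof -
    have "card (R `` {v}) + card (R\<inverse> `` {v}) \<le> \<Delta>"
      using \<Delta>(2)[OF that] card_orientation_neighbours[OF R(1) finE] by metis
    \<comment> \<open>With no outgoing arc the in-degree is at most
      \<open>\<Delta> \<le> 2 * (\<Delta> - 1)\<close>, by \<open>\<Delta> \<ge> 2\<close>; with one
      outgoing arc it is at most \<open>\<Delta> - 1\<close>.\<close>
    then have "card (R\<inverse> `` {v}) + (\<Delta> - 1) * card (R `` {v}) \<le> 2 * (\<Delta> - 1)"
      using \<Delta>(1) card_single_valued[OF R(2), of v] by (cases "card (R `` {v})") auto
    then have "real (card (R\<inverse> `` {v}) + (\<Delta> - 1) * card (R `` {v})) \<le> real (2 * (\<Delta> - 1))"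
      by (rule of_nat_mono)
    then have "s * c v \<ge> 0" using \<Delta>(1) by (simp add: sc of_nat_diff)
    then show ?thesis using s(1) by (simp add: zero_le_mult_iff)
  qed
  define T where "T v = (\<alpha> * (real \<Delta> - real (card (E `` {v}))) + (1 - \<alpha>) * c v) * (f v)\<^sup>2" for v
  have T: "T v \<ge> 0" if "v \<in> V" for v
    unfolding T_def using \<Delta>(2)[OF that] c[OF that] \<alpha> by simp
  let ?N = "\<Sum>v\<in>V. (f v)\<^sup>2" and ?S = "\<Sum>(v, u)\<in>R. (s * f v - f u)\<^sup>2 / s"
  have gap: "(b - k) * ?N = (\<Sum>v\<in>V. T v) + (1 - \<alpha>) * ?S"
    unfolding b_def s_def[symmetric] T_def c_def by (rule orientation_gap[OF V E R(1) s(1) eq])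
  have S0: "?S \<ge> 0" and T0: "(\<Sum>v\<in>V. T v) \<ge> 0"
    using s(1) T by (auto intro!: sum_nonneg)
  have "?N > 0" using nz V by (auto intro!: sum_pos2)
  moreover have "(b - k) * ?N \<ge> 0" using gap S0 T0 \<alpha> by simp
  ultimately show "k \<le> b" by (simp add: zero_le_mult_iff)
  assume kb: "k = b" and a1: "\<alpha> < 1"
  have "(1 - \<alpha>) * ?S \<ge> 0" using S0 \<alpha> by simp
  moreover have "(\<Sum>v\<in>V. T v) + (1 - \<alpha>) * ?S = 0" using gap kb by simp
  ultimately have Tz: "(\<Sum>v\<in>V. T v) = 0" and "(1 - \<alpha>) * ?S = 0" using T0 by linarith+
  then have Sz: "?S = 0" using a1 by simp
  show "f v = 0 \<longleftrightarrow> f u = 0" if "(v, u) \<in> R"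
  proof -
    have "\<forall>e\<in>R. (case e of (v, u) \<Rightarrow> (s * f v - f u)\<^sup>2 / s) = 0"
      using Sz finR s(1) by (subst (asm) sum_nonneg_eq_0_iff) auto
    then have "s * f v = f u" using that s(1) by auto
    then show ?thesis using s(1) by auto
  qed
  show "(\<Delta> - 1) * card (R `` {v}) + card (R\<inverse> `` {v}) = 2 * (\<Delta> - 1)" if v: "v \<in> V" "f v \<noteq> 0"
  proof -
    have "T v = 0" using Tz V T v(1) by (simp add: sum_nonneg_eq_0_iff)
    then have "\<alpha> * (real \<Delta> - real (card (E `` {v}))) + (1 - \<alpha>) * c v = 0"
      using v(2) by (simp add: T_def)
    moreover have "\<alpha> * (real \<Delta> - real (card (E `` {v}))) \<ge> 0" "(1 - \<alpha>) * c v \<ge> 0"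
      using \<Delta>(2)[OF v(1)] c[OF v(1)] \<alpha> by simp_all
    ultimately have "(1 - \<alpha>) * c v = 0" by linarith
    then have "s * c v = 0" using a1 by simp
    then have "real ((\<Delta> - 1) * card (R `` {v}) + card (R\<inverse> `` {v})) = real (2 * (\<Delta> - 1))"
      using \<Delta>(1) unfolding sc by (simp add: of_nat_diff)
    then show ?thesis by (simp only: of_nat_eq_iff)
  qed
qed

section \<open>From graphs to arc relations\<close>

lemma pair_graph_arcs:
  assumes "pair_graph G"
  shows "finite (pverts G)" "finite (parcs G)" "sym (parcs G)" "irrefl (parcs G)"
    "parcs G \<subseteq> pverts G \<times> pverts G"
proof -
  interpret pair_graph G by fact
  show "finite (pverts G)" "finite (parcs G)" by (fact pair_finite_verts pair_finite_arcs)+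
  show "sym (parcs G)" using pair_sym_arcs by (simp add: symmetric_def)
  show "irrefl (parcs G)" using no_loops' by (auto simp: irrefl_def)
  show "parcs G \<subseteq> pverts G \<times> pverts G" using in_arcsD1 in_arcsD2 by auto
qed

text \<open>A walk starting in \<open>S\<close> never leaves \<open>S\<close>. In this form
  connectedness applies both to the support of an eigenvector and to the vertex set of a
  cycle.\<close>

lemma connected_closed_eq_verts:
  assumes "Digraph_Component.connected (with_proj G)" "sym (parcs G)"
    and S: "S \<noteq> {}" "S \<subseteq> pverts G" "parcs G `` S \<subseteq> S"
  shows "S = pverts G"
proof -
  \<comment> \<open>Connectedness is strong connectedness of the symmetric closure, which adds
    nothing to a symmetric arc set.\<close>
  have arcs: "parcs (mk_symmetric (with_proj G)) = parcs G"
    using assms(2) by (auto simp: parcs_mk_symmetric dest: symD)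
  from S(1,2) obtain u where u: "u \<in> S" "u \<in> pverts G" by auto
  have "v \<in> S" if "v \<in> pverts G" for v
  proof -
    have "u \<rightarrow>\<^sup>*\<^bsub>mk_symmetric (with_proj G)\<^esub> v"
      using assms(1) u(2) that by (auto simp: connected_def strongly_connected_def)
    then have "(u, v) \<in> rtrancl_on (pverts G) (parcs G)" by (simp add: reachable_def arcs)
    then show ?thesis using u(1) S(3) by induction auto
  qed
  then show ?thesis using S(2) by auto
qed

lemma cycle_in_if_is_cycle:
  assumes "pair_graph G" "is_cycle (parcs G) us"
  shows "cycle_in \<lparr>pverts = set us, parcs = cycle_arcs us\<rparr> G"
proof -
  let ?C = "\<lparr>pverts = set us, parcs = cycle_arcs us\<rparr>"
  have us: "3 \<le> length us" "distinct us" "cycle_arcs us \<subseteq> parcs G"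
    using assms(2) by (auto simp: is_cycle_def)
  have sub: "set us \<subseteq> pverts G"
  proof
    fix v assume "v \<in> set us"
    then have "cycle_arcs us `` {v} \<noteq> {}" using card_cycle_neighbours[OF us(1,2)] by force
    then show "v \<in> pverts G" using us(3) pair_graph_arcs(5)[OF assms(1)] by auto
  qed
  have "wf_digraph (with_proj ?C)"
    using cycle_arcs_subset_set[of us] by unfold_locales auto
  moreover have "wf_digraph (with_proj G)"
    using pair_graph_arcs(5)[OF assms(1)] by unfold_locales auto
  ultimately have "subgraph (with_proj ?C) (with_proj G)"
    using sub us(3) by (simp add: subgraph_def compatible_def)
  moreover have "cycle_graph ?C" using us(1,2) by (auto simp: cycle_graph_iff)
  ultimately show ?thesis by (simp add: cycle_in_def)
qed

text \<open>In a tree the given cycles are contradictory; in a unicyclic graph they are equal as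
  subgraphs, hence in their arcs.\<close>

lemma tree_or_unicyclic_cycle_unique:
  assumes "tree_graph G \<or> unicyclic_graph G"
    and "is_cycle (parcs G) us" "is_cycle (parcs G) ws"
  shows "cycle_arcs us = cycle_arcs ws"
proof -
  let ?C = "\<lambda>us. \<lparr>pverts = set us, parcs = cycle_arcs us\<rparr>"
  have G: "pair_graph G" using assms(1) by (auto simp: tree_graph_def unicyclic_graph_def)
  have "cycle_in (?C us) G" "cycle_in (?C ws) G"
    using cycle_in_if_is_cycle[OF G] assms(2,3) by auto
  then have "?C us = ?C ws" using assms(1) unfolding tree_graph_def unicyclic_graph_def by metis
  then show ?thesis by simp
qed

section \<open>The bound and its equality case\<close>

text \<open>In-degrees and out-degrees both sum to the number of arcs, so the differences, all
  nonnegative, add up to zero.\<close>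

lemma degrees_eq_1_if_in_degree_pos:
  assumes V: "finite V" "R \<subseteq> V \<times> V"
    and out: "\<And>v. v \<in> V \<Longrightarrow> card (R `` {v}) \<le> 1"
    and ins: "\<And>v. v \<in> V \<Longrightarrow> card (R\<inverse> `` {v}) \<ge> 1"
    and v: "v \<in> V"
  shows "card (R `` {v}) = 1" "card (R\<inverse> `` {v}) = 1"
proof -
  have fin: "finite R" "finite (R\<inverse>)" using V by (auto intro: finite_subset)
  have fib: "(\<Sum>v\<in>V. card (T `` {v})) = card T" if "T \<subseteq> V \<times> V" "finite T" for T
  proof -
    have "(\<Sum>v\<in>V. card (T `` {v})) = card (Sigma V (\<lambda>v. T `` {v}))"
      using V that by (subst card_SigmaI) auto
    also have "Sigma V (\<lambda>v. T `` {v}) = T" using that by auto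
    finally show ?thesis .
  qed
  have "(\<Sum>v\<in>V. card (R `` {v})) = (\<Sum>v\<in>V. card (R\<inverse> `` {v}))"
  proof -
    have "R\<inverse> \<subseteq> V \<times> V" using V(2) by blast
    then show ?thesis by (simp only: fib[OF V(2) fin(1)] fib[OF _ fin(2)] card_inverse)
  qed
  then have "int (\<Sum>v\<in>V. card (R `` {v})) = int (\<Sum>v\<in>V. card (R\<inverse> `` {v}))" by (rule arg_cong)
  then have "(\<Sum>v\<in>V. int (card (R\<inverse> `` {v})) - int (card (R `` {v}))) = 0"
    by (simp add: sum_subtractf)
  moreover have "int (card (R\<inverse> `` {v})) - int (card (R `` {v})) \<ge> 0" if "v \<in> V" for v
    using out[OF that] ins[OF that] by simp
  ultimately have "int (card (R\<inverse> `` {v})) - int (card (R `` {v})) = 0"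
    using V(1) v by (simp add: sum_nonneg_eq_0_iff)
  then show "card (R `` {v}) = 1" "card (R\<inverse> `` {v}) = 1" using out[OF v] ins[OF v] by auto
qed

theorem theorem3p1:
  fixes G :: "'v pair_pre_digraph" and vs :: "'v list" and \<alpha> :: real
  assumes "tree_graph G \<or> unicyclic_graph G"
    and "max_degree G \<ge> 2"
    and "enumerates_verts vs G"
    and "0 \<le> \<alpha>" and "\<alpha> \<le> 1"
  shows "rho_alpha \<alpha> G vs
           \<le> \<alpha> * real (max_degree G) + 2 * (1 - \<alpha>) * sqrt (real (max_degree G) - 1) \<and>
         (\<alpha> < 1 \<longrightarrow>
           (rho_alpha \<alpha> G vs
              = \<alpha> * real (max_degree G) + 2 * (1 - \<alpha>) * sqrt (real (max_degree G) - 1)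
            \<longleftrightarrow> cycle_graph G))"
proof -
  let ?V = "pverts G" and ?E = "parcs G" and ?\<Delta> = "max_degree G"
  let ?A = "A_alpha \<alpha> G vs"
  let ?b = "\<alpha> * real ?\<Delta> + 2 * (1 - \<alpha>) * sqrt (real ?\<Delta> - 1)"
  have G: "pair_graph G" and conn: "Digraph_Component.connected (with_proj G)"
    using assms(1) by (auto simp: tree_graph_def unicyclic_graph_def)
  note arcs = pair_graph_arcs[OF G]
  have "?V \<noteq> {}" using conn by (auto simp: connected_def strongly_connected_def)
  then have "vs \<noteq> []" using assms(3) by (auto simp: enumerates_verts_def)
  note spec = spectrum_A_alpha[OF arcs(3) \<open>vs \<noteq> []\<close>, of \<alpha>]
  note ev_iff = eigenvalue_A_alpha_iff[OF assms(3) arcs(5), of \<alpha>, unfolded degree_of_eq]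
  have \<Delta>: "card (?E `` {v}) \<le> ?\<Delta>" if "v \<in> ?V" for v
    using that arcs(1) by (auto simp: max_degree_def degree_of_eq)
  obtain R where R: "orientation ?E R" "single_valued R"
    using unicyclic_orientation[OF arcs(2-4)] tree_or_unicyclic_cycle_unique[OF assms(1)] by metis
  have rho: "eigenvalue ?A (rho_alpha \<alpha> G vs)"
    using Max_in[OF spec] by (simp add: rho_alpha_def spectrum_def)
  then obtain f where nz: "\<exists>v\<in>?V. f v \<noteq> 0" and eq: "\<And>v. v \<in> ?V \<Longrightarrow>
      \<alpha> * real (card (?E `` {v})) * f v + (1 - \<alpha>) * (\<Sum>u\<in>?E `` {v}. f u) = rho_alpha \<alpha> G vs * f v"
    unfolding ev_iff by blast
  note bound = oriented_eigenvalue_bound[where f = f and k = "rho_alpha \<alpha> G vs",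
      OF arcs(1,5) R assms(2) \<Delta> assms(4,5) eq nz]
  have le: "rho_alpha \<alpha> G vs \<le> ?b" by (rule bound(1))
  moreover have "cycle_graph G" if a1: "\<alpha> < 1" and tight: "rho_alpha \<alpha> G vs = ?b"
  proof -
    have zero: "f v = 0 \<longleftrightarrow> f u = 0" if "(v, u) \<in> R" for v u
      by (rule bound(2)[OF _ _ tight a1 that])
    \<comment> \<open>By \<open>zero\<close>, \<open>f\<close> vanishes at both ends of an edge or
      at neither, so its nonempty support is closed under adjacency.\<close>
    have "{v \<in> ?V. f v \<noteq> 0} = ?V"
    proof (rule connected_closed_eq_verts[OF conn arcs(3)])
      show "?E `` {v \<in> ?V. f v \<noteq> 0} \<subseteq> {v \<in> ?V. f v \<noteq> 0}"
        using arcs(5) R(1) zero by (auto simp: orientation_def)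
    qed (use nz in auto)
    then have deg: "(?\<Delta> - 1) * card (R `` {v}) + card (R\<inverse> `` {v}) = 2 * (?\<Delta> - 1)"
      if "v \<in> ?V" for v
      using bound(3)[OF _ _ tight a1 that] that by auto
    have RV: "R \<subseteq> ?V \<times> ?V" using R(1) arcs(5) by (auto simp: orientation_def)
    have out: "card (R `` {v}) \<le> 1" for v using card_single_valued[OF R(2)] .
    \<comment> \<open>Out-degree 0 forces in-degree \<open>2 * (?\<Delta> - 1)\<close>, and
      out-degree 1 forces \<open>?\<Delta> - 1\<close>; both are positive.\<close>
    have "card (R\<inverse> `` {v}) \<ge> 1" if "v \<in> ?V" for v
      using deg[OF that] out[of v] assms(2) by (cases "card (R `` {v})") auto
    from degrees_eq_1_if_in_degree_pos[OF arcs(1) RV out this]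
    have deg2: "card (?E `` {v}) = 2" if "v \<in> ?V" for v
      using that card_orientation_neighbours[OF R(1) arcs(2)] by simp
    obtain us where "3 \<le> length us" "distinct us" "?V = set us" "?E = cycle_arcs us"
    proof (rule connected_2_regular_is_cycle[OF arcs(2-5) \<open>?V \<noteq> {}\<close>])
      show "S = ?V" if "S \<noteq> {}" "S \<subseteq> ?V" "?E `` S \<subseteq> S" for S
        using connected_closed_eq_verts[OF conn arcs(3) that] .
    qed (use deg2 in auto)
    then show ?thesis by (auto simp: cycle_graph_iff)
  qed
  moreover have "rho_alpha \<alpha> G vs = ?b" if "cycle_graph G"
  proof -
    have deg: "card (?E `` {v}) = 2" if "v \<in> ?V" for v
      using \<open>cycle_graph G\<close> that card_cycle_neighbours by (auto simp: cycle_graph_iff)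
    then have "degree_of G ` ?V = {2}" using \<open>?V \<noteq> {}\<close> by (auto simp: degree_of_eq)
    then have "?\<Delta> = 2" by (simp add: max_degree_def)
    then have b: "?b = 2" by (simp add: algebra_simps)
    \<comment> \<open>On a cycle the constant function attains the bound, as
      \<open>2 * \<alpha> + 2 * (1 - \<alpha>) = 2\<close> at every vertex.\<close>
    have "eigenvalue ?A 2"
      unfolding ev_iff using \<open>?V \<noteq> {}\<close> by (intro exI[of _ "\<lambda>_. 1"]) (auto simp: deg algebra_simps)
    then have "2 \<le> rho_alpha \<alpha> G vs"
      using spec(1) by (simp add: rho_alpha_def spectrum_def)
    then show ?thesis using le b by linarith
  qed
  ultimately show ?thesis by blast
qed

end
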